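(* Let $n\in\mathbb N$, $A\in M_n(\mathbb R)$ and $\hat\alpha=(\alpha_1,\ldots,\alpha_n)\in\left((0,1]\cap\mathbb Q\right)^n$. For each $i\in\{1,\ldots,n\}$ write $\alpha_i=q_i/m_i$ with $q_i,m_i\in\mathbb N$ in lowest terms. Let $m$ be the least common multiple of $m_1,\ldots,m_n$, let $p_i=q_i\frac{m}{m_i}\in\mathbb N$ for each $i$, let $\gamma=\frac1m$, and let $d=p_1+p_2+\cdots+p_n$. Define real numbers $b_0,\ldots,b_d$ by $b_d=1$, $b_0=(-1)^n\det A$, and, for $0<k<d$, $$b_k=\sum (-1)^{n-r}\det A_{(i_1,\ldots,i_r)},$$ where the sum is over all $r$ with $1\le r\le n$ and all index sets $1\le i_1<\cdots<i_r\le n$ with $p_{i_1}+\cdots+p_{i_r}=k$ (so $b_k=0$ if there are no such index sets), and $A_{(i_1,\ldots,i_r)}$ denotes the matrix obtained from $A$ by deleting the rows $i_1,\ldots,i_r$ and the columns $i_1,\ldots,i_r$. Let $B$ be the $d\times d$ matrix $$B=\begin{pmatrix}0&0&\cdots&0&-b_0\\1&0&\cdots&0&-b_1\\0&1&&0&-b_2\\\vdots&&\ddots&\vdots&\vdots\\0&0&\cdots&1&-b_{d-1}\end{pmatrix},$$ i.e. the matrix with ones on the subdiagonal, last column $(-b_0,-b_1,\ldots,-b_{d-1})^{\mathrm T}$, and all other entries zero (and $B=(-b_0)$ if $d=1$). Put $$\tilde\sigma^\gamma(B)=\{s\in\mathbb C:\ -\gamma\pi<\arg(s)\le\gamma\pi,\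 \det(sI-B)=0\},$$ $$\Omega_\gamma=\left\{z\in\mathbb C\setminus\{0\}:\ |\arg(z)|>\gamma\tfrac{\pi}{2},\ -\gamma\pi<\arg(z)\le\gamma\pi\right\}.$$ Then $\sigma_{\hat\alpha}(A)\subset\mathbb C_-$ if and only if $\tilde\sigma^\gamma(B)\subset\Omega_\gamma$.
   Context: $\mathbb N=\{1,2,\ldots\}$. $M_n(\mathbb R)$ is the set of real $n\times n$ matrices, $I$ is the identity matrix, and $\mathbb C_-=\{z\in\mathbb C:\Re(z)<0\}$. Arguments are principal, $\arg(z)\in(-\pi,\pi]$, with the convention $\arg(0)=0$. For $\beta\in(0,1]$ the power is the principal branch $z^\beta=|z|^\beta\exp(\mathrm i\beta\arg(z))$, so $0^\beta=0$. The $\hat\alpha$-order spectrum of $A$ is $$\sigma_{\hat\alpha}(A)=\{z\in\mathbb C:\det(\operatorname{diag}(z^{\alpha_1},\ldots,z^{\alpha_n})-A)=0\}.$$ *)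

theory Defs
  imports
    "HOL-Analysis.Complex_Transcendental"
    "Jordan_Normal_Form.Determinant"
    "Jordan_Normal_Form.DL_Submatrix"
begin

text \<open>Matrix rows and columns, and the components of a multi-order, are indexed from 0.\<close>

text \<open>\<open>powr\<close> with a real exponent is the principal branch, with \<open>0 powr \<beta> = 0\<close>, and \<open>Arg\<close> takes
  values in \<open>(-\<pi>, \<pi>]\<close>, with \<open>Arg 0 = 0\<close>:\<close>

lemma powr_principal_branch:
  "z powr complex_of_real \<beta> = complex_of_real (norm z powr \<beta>) * exp (\<i> * complex_of_real (\<beta> * Arg z))"
proof (cases "z = 0")
  case False
  then have "Ln z = complex_of_real (ln (norm z)) + \<i> * complex_of_real (Arg z)"
    by (intro complex_eqI) (simp_all add: Arg_def)
  then have "z powr complex_of_real \<beta>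
      = exp (complex_of_real (\<beta> * ln (norm z)) + \<i> * complex_of_real (\<beta> * Arg z))"
    using False by (simp add: powr_def algebra_simps)
  also have "\<dots> = complex_of_real (norm z powr \<beta>) * exp (\<i> * complex_of_real (\<beta> * Arg z))"
    unfolding exp_add using False by (simp add: powr_def flip: exp_of_real)
  finally show ?thesis .
qed simp

definition order_spectrum :: "(nat \<Rightarrow> real) \<Rightarrow> real mat \<Rightarrow> complex set" where
  "order_spectrum \<alpha> A =
    {z. det (mat_diag (dim_row A) (\<lambda>i. z powr complex_of_real (\<alpha> i)) - map_mat complex_of_real A) = 0}"

definition left_half_plane :: "complex set" where
  "left_half_plane = {z. Re z < 0}"

definition delete_rows_cols :: "'a mat \<Rightarrow> nat set \<Rightarrow> 'a mat" where
  "delete_rows_cols A S = submatrix A (- S) (- S)"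

text \<open>The index set \<open>{i\<^sub>1 < \<dots> < i\<^sub>r}\<close> is the finite set \<open>S\<close>, so that \<open>r = card S\<close>.\<close>

definition b_coeff :: "real mat \<Rightarrow> (nat \<Rightarrow> nat) \<Rightarrow> nat \<Rightarrow> real" where
  "b_coeff A p k =
    (let n = dim_row A; d = (\<Sum>i<n. p i) in
     if k = d then 1
     else if k = 0 then (-1) ^ n * det A
     else (\<Sum>S | S \<subseteq> {..<n} \<and> S \<noteq> {} \<and> (\<Sum>i\<in>S. p i) = k.
             (-1) ^ (n - card S) * det (delete_rows_cols A S)))"

definition companion_matrix :: "nat \<Rightarrow> (nat \<Rightarrow> real) \<Rightarrow> real mat" where
  "companion_matrix d b =
    mat d d (\<lambda>(i, j). if j = d - 1 then - b i else if i = j + 1 then 1 else 0)"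

definition sector_spectrum :: "real \<Rightarrow> real mat \<Rightarrow> complex set" where
  "sector_spectrum \<gamma> B =
    {s. - \<gamma> * pi < Arg s \<and> Arg s \<le> \<gamma> * pi \<and>
        det (s \<cdot>\<^sub>m 1\<^sub>m (dim_row B) - map_mat complex_of_real B) = 0}"

definition Omega_sector :: "real \<Rightarrow> complex set" where
  "Omega_sector \<gamma> =
    {z. z \<noteq> 0 \<and> \<bar>Arg z\<bar> > \<gamma> * (pi / 2) \<and> - \<gamma> * pi < Arg z \<and> Arg z \<le> \<gamma> * pi}"

end

theory Submission
  imports Defs
begin

text \<open>Every \<open>z\<close> has exactly one \<open>M\<close>-th root \<open>s\<close> whose argument lies in \<open>(-\<pi>/M, \<pi>/M]\<close>, the principal
  one, and it turns all the fractional powers into ordinary ones: since \<open>\<alpha>\<^sub>i = p\<^sub>i / M\<close>, the power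
  \<open>z\<^bsup>\<alpha>\<^sub>i\<^esup>\<close> is \<open>s\<^bsup>p\<^sub>i\<^esup>\<close> (lemmas \<open>sector_root_exists\<close> and \<open>powr_power_sector\<close>). The equation that
  defines the order spectrum thus becomes the polynomial equation
  \<open>det (diag (s\<^bsup>p\<^sub>1\<^esup>, \<dots>, s\<^bsup>p\<^sub>n\<^esup>) - A) = 0\<close> in \<open>s\<close>.

  Expanding this determinant along its diagonal summands gives a sum over index sets \<open>S\<close> of
  \<open>\<Prod>i\<in>S. s\<^bsup>p\<^sub>i\<^esup>\<close> times a signed principal minor of \<open>A\<close> (\<open>det_mat_diag_minus\<close>). Collecting the sets
  with the same exponent \<open>k = \<Sum>i\<in>S. p\<^sub>i\<close> yields the monic polynomial with coefficients \<open>b\<^sub>k\<close>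
  (\<open>det_diag_powers_minus\<close>), whose roots are the eigenvalues of its companion matrix
  (\<open>det_companion_matrix_eq_0_iff\<close>). So \<open>s \<mapsto> s\<^bsup>M\<^esup>\<close> maps the sector spectrum of \<open>B\<close> onto the order
  spectrum of \<open>A\<close>. On the sector this map multiplies arguments by \<open>M\<close>, and the open left half plane
  is the set of points with \<open>\<bar>arg z\<bar> > \<pi>/2\<close>, so \<open>s\<^bsup>M\<^esup>\<close> lies there exactly when \<open>s\<close> lies in the
  region \<open>\<Omega>\<close> (\<open>power_in_left_half_plane_iff\<close>). Zero is a solution on one side if and only if it is one
  on the other, and both regions leave it out.\<close>

section \<open>Principal minors\<close>

lemma bij_betw_pick:
  "bij_betw (pick I) {..<card {i. i < n \<and> i \<in> I}} {i. i < n \<and> i \<in> I}"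
proof -
  let ?T = "{i. i < n \<and> i \<in> I}"
  have small: "k < card I \<or> infinite I" if "k < card ?T" for k
  proof (cases "finite I")
    case True
    then have "card ?T \<le> card I" by (intro card_mono) auto
    with that show ?thesis by simp
  qed simp
  have "inj_on (pick I) {..<card ?T}"
  proof (rule linorder_inj_onI)
    fix x y assume "x < y" "x \<in> {..<card ?T}" "y \<in> {..<card ?T}"
    then have "pick I x < pick I y" using small[of y] pick_mono by auto
    then show "pick I x \<noteq> pick I y" by simp
  qed auto
  moreover have "pick I ` {..<card ?T} \<subseteq> ?T"
  proof (rule image_subsetI)
    fix k assume k: "k \<in> {..<card ?T}"
    then have "pick I k \<in> I" using small[of k] pick_in_set by auto
    moreover have "pick I k < n"
    proof (rule ccontr)
      assume "\<not> pick I k < n"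
      then have "card {a \<in> I. a < n} \<le> k"
        using small[of k] card_le_pick k by auto
      with k show False by (simp add: conj_commute)
    qed
    ultimately show "pick I k \<in> ?T" by simp
  qed
  moreover from calculation have "pick I ` {..<card ?T} = ?T"
    by (intro card_subset_eq) (simp_all add: card_image)
  ultimately show ?thesis by (simp add: bij_betw_def)
qed

text \<open>A principal submatrix lists its rows and columns by position, whereas the diagonal expansion
  below produces permutations of the index set \<open>T\<close> itself. Conjugation by \<open>f\<close> translates one into
  the other and preserves signs.\<close>

lemma det_reindex:
  fixes f :: "nat \<Rightarrow> nat" and A :: "'a :: comm_ring_1 mat"
  assumes f: "bij_betw f {..<k} T"
  shows "det (mat k k (\<lambda>(i, j). A $$ (f i, f j)))
    = (\<Sum>\<pi> | \<pi> permutes T. signof \<pi> * (\<Prod>i\<in>T. A $$ (i, \<pi> i)))"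
proof -
  let ?K = "{..<k}"
  let ?h = "map_permutation ?K f"
  have inj: "inj_on f ?K" and im: "f ` ?K = T" using f by (auto simp: bij_betw_def)
  have g: "bij_betw (inv_into ?K f) T ?K" using f by (rule bij_betw_inv_into)
  have bij: "bij_betw ?h {\<pi>. \<pi> permutes ?K} {\<pi>. \<pi> permutes T}"
  proof (rule bij_betw_byWitness[where f' = "map_permutation T (inv_into ?K f)"])
    show "\<forall>\<pi>\<in>{\<pi>. \<pi> permutes ?K}. map_permutation T (inv_into ?K f) (?h \<pi>) = \<pi>"
      using map_permutation_compose_inv[OF f] inj by auto
    show "\<forall>\<pi>\<in>{\<pi>. \<pi> permutes T}. ?h (map_permutation T (inv_into ?K f) \<pi>) = \<pi>"
      using map_permutation_compose_inv[OF g] im by (auto simp: f_inv_into_f)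
    show "?h ` {\<pi>. \<pi> permutes ?K} \<subseteq> {\<pi>. \<pi> permutes T}"
      using map_permutation_permutes[OF f] by auto
    show "map_permutation T (inv_into ?K f) ` {\<pi>. \<pi> permutes T} \<subseteq> {\<pi>. \<pi> permutes ?K}"
      using map_permutation_permutes[OF g] by auto
  qed
  have "det (mat k k (\<lambda>(i, j). A $$ (f i, f j)))
      = (\<Sum>\<pi> | \<pi> permutes ?K. signof \<pi> * (\<Prod>i\<in>?K. A $$ (f i, f (\<pi> i))))"
    by (subst det_def'[of _ k])
      (auto simp: atLeast0LessThan intro!: sum.cong prod.cong dest: permutes_in_image)
  also have "\<dots> = (\<Sum>\<pi> | \<pi> permutes ?K. signof (?h \<pi>) * (\<Prod>i\<in>T. A $$ (i, ?h \<pi> i)))"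
  proof (rule sum.cong[OF refl])
    fix \<pi> assume "\<pi> \<in> {\<pi>. \<pi> permutes ?K}"
    then have \<pi>: "\<pi> permutes ?K" by simp
    have "(\<Prod>i\<in>T. A $$ (i, ?h \<pi> i)) = (\<Prod>i\<in>?K. A $$ (f i, ?h \<pi> (f i)))"
      by (rule prod.reindex_bij_betw[OF f, symmetric])
    also have "\<dots> = (\<Prod>i\<in>?K. A $$ (f i, f (\<pi> i)))"
      by (rule prod.cong) (simp_all add: map_permutation_apply[OF inj])
    finally show "signof \<pi> * (\<Prod>i\<in>?K. A $$ (f i, f (\<pi> i)))
        = signof (?h \<pi>) * (\<Prod>i\<in>T. A $$ (i, ?h \<pi> i))"
      by (simp add: sign_map_permutation[OF inj \<pi>])
  qed
  also have "\<dots> = (\<Sum>\<pi> | \<pi> permutes T. signof \<pi> * (\<Prod>i\<in>T. A $$ (i, \<pi> i)))"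
    by (rule sum.reindex_bij_betw[OF bij])
  finally show ?thesis .
qed

lemma det_delete_rows_cols:
  fixes A :: "'a :: comm_ring_1 mat"
  assumes A: "A \<in> carrier_mat n n"
  shows "det (delete_rows_cols A S)
    = (\<Sum>\<pi> | \<pi> permutes {..<n} - S. signof \<pi> * (\<Prod>i\<in>{..<n} - S. A $$ (i, \<pi> i)))"
proof -
  have T: "{i. i < n \<and> i \<in> - S} = {..<n} - S" by auto
  have "delete_rows_cols A S = mat (card ({..<n} - S)) (card ({..<n} - S))
      (\<lambda>(i, j). A $$ (pick (- S) i, pick (- S) j))"
    using A by (simp only: delete_rows_cols_def submatrix_def T carrier_matD)
  then show ?thesis
    using det_reindex[OF bij_betw_pick[of "- S" n, unfolded T], of A] by simp
qed

text \<open>Multiply out each product in the Leibniz formula, \<open>S\<close> being the set of rows where the diagonal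
  summand is chosen. For a given \<open>S\<close> only the permutations fixing \<open>S\<close> pointwise survive; they are the
  permutations of the complement, and they sum up to the minor without the rows and columns in \<open>S\<close>.\<close>

lemma det_mat_diag_minus:
  fixes A :: "'a :: comm_ring_1 mat"
  assumes A: "A \<in> carrier_mat n n"
  shows "det (mat_diag n D - A)
    = (\<Sum>S\<in>Pow {..<n}. (\<Prod>i\<in>S. D i) * ((-1) ^ (n - card S) * det (delete_rows_cols A S)))"
proof -
  let ?N = "{..<n}"
  let ?P = "{\<pi>. \<pi> permutes ?N}"
  have "det (mat_diag n D - A)
      = (\<Sum>\<pi>\<in>?P. signof \<pi> * (\<Prod>i\<in>?N. (if i = \<pi> i then D i else 0) - A $$ (i, \<pi> i)))"
  proof -
    have carrier: "mat_diag n D - A \<in> carrier_mat n n"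
      using A by (rule minus_carrier_mat)
    have entry: "(mat_diag n D - A) $$ (i, \<pi> i) = (if i = \<pi> i then D i else 0) - A $$ (i, \<pi> i)"
      if "\<pi> permutes ?N" "i \<in> ?N" for \<pi> i
    proof -
      have "\<pi> i < n" using permutes_in_image[OF that(1), of i] that(2) by simp
      with that(2) A show ?thesis by (auto simp: mat_diag_def)
    qed
    show ?thesis
      unfolding det_def'[OF carrier] atLeast0LessThan
    proof (intro sum.cong refl)
      fix \<pi> assume "\<pi> \<in> ?P"
      then show "signof \<pi> * (\<Prod>i\<in>?N. (mat_diag n D - A) $$ (i, \<pi> i))
          = signof \<pi> * (\<Prod>i\<in>?N. (if i = \<pi> i then D i else 0) - A $$ (i, \<pi> i))"
        using entry by simp
    qed
  qed
  also have "\<dots> = (\<Sum>\<pi>\<in>?P. \<Sum>S\<in>Pow ?N. signof \<pi> *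
      ((-1) ^ (n - card S) * (\<Prod>i\<in>S. if i = \<pi> i then D i else 0) * (\<Prod>i\<in>?N - S. A $$ (i, \<pi> i))))"
    by (simp add: prod_diff_conv_sum' sum_distrib_left)
  also have "\<dots> = (\<Sum>S\<in>Pow ?N. \<Sum>\<pi>\<in>?P. signof \<pi> *
      ((-1) ^ (n - card S) * (\<Prod>i\<in>S. if i = \<pi> i then D i else 0) * (\<Prod>i\<in>?N - S. A $$ (i, \<pi> i))))"
    by (rule sum.swap)
  also have "\<dots> = (\<Sum>S\<in>Pow ?N. (\<Prod>i\<in>S. D i) * ((-1) ^ (n - card S) * det (delete_rows_cols A S)))"
  proof (rule sum.cong[OF refl])
    fix S assume "S \<in> Pow ?N"
    then have S: "S \<subseteq> ?N" and finS: "finite S" by (auto intro: finite_subset)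
    have "(\<Sum>\<pi>\<in>?P. signof \<pi> * ((-1) ^ (n - card S)
          * (\<Prod>i\<in>S. if i = \<pi> i then D i else 0) * (\<Prod>i\<in>?N - S. A $$ (i, \<pi> i))))
        = (\<Sum>\<pi> | \<pi> permutes ?N - S. signof \<pi> * ((-1) ^ (n - card S)
          * (\<Prod>i\<in>S. D i) * (\<Prod>i\<in>?N - S. A $$ (i, \<pi> i))))"
    proof (rule sum.mono_neutral_cong_right)
      show "finite ?P" by (simp add: finite_permutations)
      show "{\<pi>. \<pi> permutes ?N - S} \<subseteq> ?P" by (auto intro: permutes_subset)
      show "\<forall>\<pi>\<in>?P - {\<pi>. \<pi> permutes ?N - S}. signof \<pi> * ((-1) ^ (n - card S)
          * (\<Prod>i\<in>S. if i = \<pi> i then D i else 0) * (\<Prod>i\<in>?N - S. A $$ (i, \<pi> i))) = 0"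
      proof
        fix \<pi> assume \<pi>: "\<pi> \<in> ?P - {\<pi>. \<pi> permutes ?N - S}"
        then obtain i where "i \<in> S" "i \<noteq> \<pi> i"
          using permutes_superset[of \<pi> ?N "?N - S"] by fastforce
        then have "(\<Prod>i\<in>S. if i = \<pi> i then D i else 0) = 0"
          using finS by (intro prod_zero) auto
        then show "signof \<pi> * ((-1) ^ (n - card S)
          * (\<Prod>i\<in>S. if i = \<pi> i then D i else 0) * (\<Prod>i\<in>?N - S. A $$ (i, \<pi> i))) = 0"
          by simp
      qed
      show "signof \<pi> * ((-1) ^ (n - card S)
          * (\<Prod>i\<in>S. if i = \<pi> i then D i else 0) * (\<Prod>i\<in>?N - S. A $$ (i, \<pi> i)))
        = signof \<pi> * ((-1) ^ (n - card S) * (\<Prod>i\<in>S. D i) * (\<Prod>i\<in>?N - S. A $$ (i, \<pi> i)))"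
        if "\<pi> \<in> {\<pi>. \<pi> permutes ?N - S}" for \<pi>
      proof -
        have "\<pi> i = i" if "i \<in> S" for i
          using \<open>\<pi> \<in> {\<pi>. \<pi> permutes ?N - S}\<close> that by (auto intro: permutes_not_in)
        then show ?thesis by simp
      qed
    qed
    also have "\<dots> = (\<Prod>i\<in>S. D i) * ((-1) ^ (n - card S) * det (delete_rows_cols A S))"
      by (simp add: det_delete_rows_cols[OF A] sum_distrib_left mult_ac)
    finally show "(\<Sum>\<pi>\<in>?P. signof \<pi> * ((-1) ^ (n - card S)
          * (\<Prod>i\<in>S. if i = \<pi> i then D i else 0) * (\<Prod>i\<in>?N - S. A $$ (i, \<pi> i))))
        = (\<Prod>i\<in>S. D i) * ((-1) ^ (n - card S) * det (delete_rows_cols A S))" .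
  qed
  finally show ?thesis .
qed

section \<open>The characteristic polynomial\<close>

text \<open>The three cases in the definition of the coefficients are one formula: as all \<open>p i\<close> are
  positive, the exponent \<open>d\<close> arises only from the full index set, whose minor is the empty
  determinant, and the exponent \<open>0\<close> only from the empty set, whose minor is \<open>det A\<close>.\<close>

lemma b_coeff_eq_sum:
  assumes A: "A \<in> carrier_mat n n" and p: "\<forall>i<n. p i \<ge> 1"
  shows "b_coeff A p k = (\<Sum>S | S \<subseteq> {..<n} \<and> (\<Sum>i\<in>S. p i) = k.
      (-1) ^ (n - card S) * det (delete_rows_cols A S))"
proof -
  let ?N = "{..<n}"
  have pos: "(\<Sum>i\<in>S. p i) > 0" if "S \<subseteq> ?N" "S \<noteq> {}" for S
    using that p by (intro sum_pos) (auto intro: finite_subset simp: Suc_le_eq)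
  have d: "dim_row A = n" using A by simp
  consider "k = (\<Sum>i<n. p i)" | "k \<noteq> (\<Sum>i<n. p i)" "k = 0" | "k \<noteq> (\<Sum>i<n. p i)" "k \<noteq> 0"
    by blast
  then show ?thesis
  proof cases
    case 1
    have "{S. S \<subseteq> ?N \<and> (\<Sum>i\<in>S. p i) = k} = {?N}"
    proof -
      have "S = ?N" if S: "S \<subseteq> ?N" "(\<Sum>i\<in>S. p i) = k" for S
      proof (rule ccontr)
        assume "S \<noteq> ?N"
        then have "(\<Sum>i\<in>?N - S. p i) > 0" using S by (intro pos) auto
        moreover have "(\<Sum>i\<in>?N. p i) = (\<Sum>i\<in>?N - S. p i) + (\<Sum>i\<in>S. p i)"
          using S by (intro sum.subset_diff) auto
        ultimately show False using S 1 by simp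
      qed
      then show ?thesis using 1 by blast
    qed
    moreover have "det (delete_rows_cols A ?N) = 1"
      by (simp add: det_delete_rows_cols[OF A])
    ultimately show ?thesis using 1 by (simp add: b_coeff_def d)
  next
    case 2
    have "{S. S \<subseteq> ?N \<and> (\<Sum>i\<in>S. p i) = 0} = {{}}"
    proof -
      have "S = {}" if "S \<subseteq> ?N" "(\<Sum>i\<in>S. p i) = 0" for S
        using pos[OF that(1)] that(2) by (cases "S = {}") simp_all
      then show ?thesis by (intro equalityI subsetI) simp_all
    qed
    moreover have "det (delete_rows_cols A {}) = det A"
      by (simp add: det_delete_rows_cols[OF A] det_def'[OF A] atLeast0LessThan)
    ultimately show ?thesis using 2 by (auto simp: b_coeff_def d)
  next
    case 3
    then have "{S. S \<subseteq> ?N \<and> S \<noteq> {} \<and> (\<Sum>i\<in>S. p i) = k} = {S. S \<subseteq> ?N \<and> (\<Sum>i\<in>S. p i) = k}"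
      by auto
    then show ?thesis using 3 by (simp add: b_coeff_def d)
  qed
qed

lemma det_diag_powers_minus:
  fixes s :: complex
  assumes A: "A \<in> carrier_mat n n" and p: "\<forall>i<n. p i \<ge> 1"
    and d: "d = (\<Sum>i<n. p i)"
  shows "det (mat_diag n (\<lambda>i. s ^ p i) - map_mat complex_of_real A)
    = s ^ d + (\<Sum>k<d. complex_of_real (b_coeff A p k) * s ^ k)"
proof -
  let ?N = "{..<n}"
  let ?c = "\<lambda>S. (-1) ^ (n - card S) * det (delete_rows_cols A S)"
  have cA: "map_mat complex_of_real A \<in> carrier_mat n n" using A by simp
  have hom: "det (delete_rows_cols (map_mat complex_of_real A) S)
      = complex_of_real (det (delete_rows_cols A S))" for S
  proof -
    have "(\<Prod>i\<in>?N - S. map_mat complex_of_real A $$ (i, \<pi> i))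
        = complex_of_real (\<Prod>i\<in>?N - S. A $$ (i, \<pi> i))" if "\<pi> permutes ?N - S" for \<pi>
      unfolding of_real_prod
    proof (rule prod.cong[OF refl])
      fix i assume i: "i \<in> ?N - S"
      then have "\<pi> i < n" using permutes_in_image[OF that, of i] by simp
      with i A show "map_mat complex_of_real A $$ (i, \<pi> i) = complex_of_real (A $$ (i, \<pi> i))"
        by simp
    qed
    then show ?thesis by (simp add: det_delete_rows_cols[OF A] det_delete_rows_cols[OF cA])
  qed
  have "det (mat_diag n (\<lambda>i. s ^ p i) - map_mat complex_of_real A)
      = (\<Sum>S\<in>Pow ?N. s ^ (\<Sum>i\<in>S. p i) * complex_of_real (?c S))"
    by (simp add: det_mat_diag_minus[OF cA] hom power_sum)
  also have "\<dots> = (\<Sum>k\<le>d. \<Sum>S | S \<in> Pow ?N \<and> (\<Sum>i\<in>S. p i) = k.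
      s ^ (\<Sum>i\<in>S. p i) * complex_of_real (?c S))"
    by (rule sum.group[symmetric]) (auto simp: d intro!: sum_mono2)
  also have "\<dots> = (\<Sum>k\<le>d. complex_of_real (b_coeff A p k) * s ^ k)"
    by (rule sum.cong) (simp_all add: b_coeff_eq_sum[OF A p] sum_distrib_left sum_distrib_right
        mult.commute)
  also have "\<dots> = s ^ d + (\<Sum>k<d. complex_of_real (b_coeff A p k) * s ^ k)"
    using A by (simp add: lessThan_Suc_atMost[symmetric] b_coeff_def d)
  finally show ?thesis .
qed

text \<open>The determinant vanishes iff some nonzero row vector \<open>v\<close> satisfies \<open>v (sI - B) = 0\<close>. All columns
  but the last say \<open>v\<^bsub>j+1\<^esub> = s v\<^sub>j\<close>, so \<open>v\<close> is a multiple of \<open>(1, s, \<dots>, s\<^bsup>d-1\<^esup>)\<close>, and the last column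
  then says that \<open>s\<close> is a root of the polynomial.\<close>

lemma det_companion_matrix_eq_0_iff:
  fixes s :: complex
  assumes d: "d \<ge> 1"
  shows "det (s \<cdot>\<^sub>m 1\<^sub>m d - map_mat complex_of_real (companion_matrix d b)) = 0
    \<longleftrightarrow> s ^ d + (\<Sum>k<d. complex_of_real (b k) * s ^ k) = 0"
proof -
  define C where "C = s \<cdot>\<^sub>m 1\<^sub>m d - map_mat complex_of_real (companion_matrix d b)"
  let ?f = "s ^ d + (\<Sum>k<d. complex_of_real (b k) * s ^ k)"
  have C: "C \<in> carrier_mat d d"
    unfolding C_def by (rule minus_carrier_mat) (simp add: companion_matrix_def)
  have entry: "C $$ (i, j) = (if i = j then s else 0)
      - (if j = d - 1 then - complex_of_real (b i) else if i = j + 1 then 1 else 0)"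
    if "i < d" "j < d" for i j
    using that by (simp add: C_def companion_matrix_def)
  have row: "(transpose_mat C *\<^sub>v v) $ j
      = (if j = d - 1 then s * v $ j + (\<Sum>i<d. complex_of_real (b i) * v $ i)
         else s * v $ j - v $ Suc j)"
    if v: "v \<in> carrier_vec d" and j: "j < d" for v j
  proof -
    have "(transpose_mat C *\<^sub>v v) $ j = (\<Sum>i<d. C $$ (i, j) * v $ i)"
      using C v j by (simp add: scalar_prod_def atLeast0LessThan)
    also have "\<dots> = (\<Sum>i<d. (if i = j then s * v $ i else 0)
        - (if j = d - 1 then - complex_of_real (b i) * v $ i else if i = Suc j then v $ i else 0))"
      using j by (intro sum.cong) (auto simp: entry algebra_simps)
    also have "\<dots> = (if j = d - 1 then s * v $ j + (\<Sum>i<d. complex_of_real (b i) * v $ i)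
         else s * v $ j - v $ Suc j)"
      using j by (auto simp: sum_subtractf sum_negf)
    finally show ?thesis .
  qed
  have "det C = 0 \<longleftrightarrow>
      (\<exists>v. v \<in> carrier_vec d \<and> v \<noteq> 0\<^sub>v d \<and> transpose_mat C *\<^sub>v v = 0\<^sub>v d)"
    using det_0_iff_vec_prod_zero[of "transpose_mat C" d] det_transpose[OF C] C by simp
  also have "\<dots> \<longleftrightarrow> ?f = 0"
  proof
    assume "\<exists>v. v \<in> carrier_vec d \<and> v \<noteq> 0\<^sub>v d \<and> transpose_mat C *\<^sub>v v = 0\<^sub>v d"
    then obtain v where v: "v \<in> carrier_vec d" "v \<noteq> 0\<^sub>v d"
      and null: "transpose_mat C *\<^sub>v v = 0\<^sub>v d" by blast
    have geometric: "v $ j = v $ 0 * s ^ j" if "j < d" for j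
      using that
    proof (induction j)
      case (Suc j)
      then have "j < d" "j \<noteq> d - 1" by auto
      then have "v $ Suc j = s * v $ j" using row[OF v(1), of j] null by simp
      also have "v $ j = v $ 0 * s ^ j" using Suc.IH \<open>j < d\<close> .
      finally show ?case by (simp only: power_Suc mult.left_commute)
    qed simp
    have "v $ 0 \<noteq> 0"
    proof
      assume "v $ 0 = 0"
      have "v = 0\<^sub>v d"
      proof (rule eq_vecI)
        fix j assume "j < dim_vec (0\<^sub>v d)"
        then show "v $ j = 0\<^sub>v d $ j" using geometric[of j] \<open>v $ 0 = 0\<close> by simp
      qed (use v(1) in simp)
      with v(2) show False by simp
    qed
    have "s * v $ (d - 1) + (\<Sum>i<d. complex_of_real (b i) * v $ i) = 0"
      using row[OF v(1), of "d - 1"] null d by simp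
    also have "s * v $ (d - 1) = v $ 0 * s ^ d"
    proof -
      have "s * v $ (d - 1) = v $ 0 * (s * s ^ (d - 1))"
        using d by (subst geometric) simp_all
      also have "s * s ^ (d - 1) = s ^ d" using d by (simp add: power_eq_if)
      finally show ?thesis .
    qed
    also have "(\<Sum>i<d. complex_of_real (b i) * v $ i)
        = v $ 0 * (\<Sum>i<d. complex_of_real (b i) * s ^ i)"
      unfolding sum_distrib_left
    proof (rule sum.cong[OF refl])
      fix i assume "i \<in> {..<d}"
      then show "complex_of_real (b i) * v $ i = v $ 0 * (complex_of_real (b i) * s ^ i)"
        using geometric[of i] by (simp only: lessThan_iff mult.left_commute)
    qed
    finally have "v $ 0 * ?f = 0" by (simp add: distrib_left)
    with \<open>v $ 0 \<noteq> 0\<close> show "?f = 0" by simp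
  next
    assume f: "?f = 0"
    define v where "v = vec d (\<lambda>i. s ^ i)"
    have v: "v \<in> carrier_vec d" by (simp add: v_def)
    have "v $ 0 = 1" using d by (simp add: v_def)
    then have "v \<noteq> 0\<^sub>v d" using d by auto
    moreover have "transpose_mat C *\<^sub>v v = 0\<^sub>v d"
    proof (rule eq_vecI)
      fix j assume "j < dim_vec (0\<^sub>v d)"
      then have j: "j < d" by simp
      show "(transpose_mat C *\<^sub>v v) $ j = 0\<^sub>v d $ j"
      proof (cases "j = d - 1")
        case True
        then have "s * s ^ j = s ^ d" using d by (cases d) simp_all
        then show ?thesis using row[OF v j] True f j by (simp add: v_def)
      next
        case False
        then have "Suc j < d" using j by simp
        then show ?thesis using row[OF v j] False j by (simp add: v_def)
      qed
    qed (use C in simp)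
    ultimately show "\<exists>v. v \<in> carrier_vec d \<and> v \<noteq> 0\<^sub>v d \<and> transpose_mat C *\<^sub>v v = 0\<^sub>v d"
      using v by blast
  qed
  finally show ?thesis by (simp add: C_def)
qed

section \<open>Principal roots\<close>

text \<open>In this sector the imaginary part of \<open>M Ln s\<close> stays within \<open>(-\<pi>, \<pi>]\<close>, so no multiple of
  \<open>2\<pi>\<i>\<close> has to be subtracted.\<close>

lemma Ln_power_sector:
  assumes "M > 0" "s \<noteq> 0" and lo: "- (1 / real M) * pi < Arg s" and hi: "Arg s \<le> 1 / real M * pi"
  shows "Ln (s ^ M) = of_nat M * Ln s"
proof (rule Ln_unique)
  show "exp (of_nat M * Ln s) = s ^ M" using assms by (simp add: exp_of_nat_mult)
  have "Im (of_nat M * Ln s) = real M * Arg s" using assms by (simp add: Arg_eq_Im_Ln)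
  then show "- pi < Im (of_nat M * Ln s)" "Im (of_nat M * Ln s) \<le> pi"
    using assms by (simp_all add: field_simps)
qed

lemma Arg_power_sector:
  assumes "M > 0" "- (1 / real M) * pi < Arg s" "Arg s \<le> 1 / real M * pi"
  shows "Arg (s ^ M) = real M * Arg s"
proof (cases "s = 0")
  case True
  then show ?thesis using assms by (simp add: Arg_zero zero_power)
next
  case False
  then show ?thesis using Ln_power_sector[OF assms(1) False assms(2,3)]
    by (simp add: Arg_eq_Im_Ln)
qed

lemma powr_power_sector:
  assumes M: "M > 0" "- (1 / real M) * pi < Arg s" "Arg s \<le> 1 / real M * pi" and k: "k > 0"
  shows "(s ^ M) powr complex_of_real (real k / real M) = s ^ k"
proof (cases "s = 0")
  case True
  then show ?thesis using assms by (simp add: zero_power)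
next
  case False
  then have "(s ^ M) powr complex_of_real (real k / real M) = exp (of_nat k * Ln s)"
    using M by (simp add: powr_def Ln_power_sector)
  then show ?thesis using False by (simp add: exp_of_nat_mult)
qed

text \<open>The root is \<open>exp (Ln z / M)\<close>, the principal one; for \<open>z = 0\<close> it is \<open>0\<close>, whose argument \<open>0\<close>
  lies in the sector as well.\<close>

lemma sector_root_exists:
  assumes M: "M > 0"
  obtains s where "- (1 / real M) * pi < Arg s" "Arg s \<le> 1 / real M * pi" "s ^ M = z"
proof (cases "z = 0")
  case True
  then show ?thesis using that[of 0] M by (simp add: Arg_zero)
next
  case False
  define w where "w = Ln z / of_nat M"
  have im: "Im w = Arg z / real M" using False by (simp add: w_def Arg_eq_Im_Ln)
  have bounds: "- (1 / real M) * pi < Im w" "Im w \<le> 1 / real M * pi"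
    using M mpi_less_Arg[of z] Arg_le_pi[of z] by (simp_all add: im field_simps)
  have le: "1 / real M * pi \<le> pi" using M by (simp add: field_simps)
  have "Arg (exp w) = Im w" using bounds le by (intro Arg_exp) linarith+
  moreover have "exp w ^ M = z"
    using False M by (simp add: exp_of_nat_mult[symmetric] w_def)
  ultimately show ?thesis using that[of "exp w"] bounds by simp
qed

lemma left_half_plane_iff_Arg: "z \<in> left_half_plane \<longleftrightarrow> \<bar>Arg z\<bar> > pi / 2"
  using Arg_Re_nonneg[of z] by (auto simp: left_half_plane_def)

lemma power_in_left_half_plane_iff:
  assumes M: "M > 0" and arg: "- (1 / real M) * pi < Arg s" "Arg s \<le> 1 / real M * pi"
  shows "s ^ M \<in> left_half_plane \<longleftrightarrow> s \<in> Omega_sector (1 / real M)"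
proof -
  have "\<bar>Arg (s ^ M)\<bar> = real M * \<bar>Arg s\<bar>" using Arg_power_sector[OF assms] by (simp add: abs_mult)
  then have "s ^ M \<in> left_half_plane \<longleftrightarrow> \<bar>Arg s\<bar> > 1 / real M * (pi / 2)"
    using M by (simp add: left_half_plane_iff_Arg field_simps)
  moreover have "s \<noteq> 0" if "\<bar>Arg s\<bar> > 1 / real M * (pi / 2)"
    using that M by (auto simp: Arg_zero divide_simps)
  ultimately show ?thesis using arg by (auto simp: Omega_sector_def)
qed

section \<open>Comparison of the two spectra\<close>

theorem theorem3p1:
  fixes n :: nat and A :: "real mat" and \<alpha> :: "nat \<Rightarrow> real"
    and q m p :: "nat \<Rightarrow> nat" and M d :: nat and \<gamma> :: real and B :: "real mat"
  assumes "n \<ge> 1"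
    and "A \<in> carrier_mat n n"
    and "\<forall>i<n. \<alpha> i \<in> {0<..1} \<inter> \<rat>"
    and "\<forall>i<n. q i \<ge> 1 \<and> m i \<ge> 1 \<and> coprime (q i) (m i) \<and> \<alpha> i = real (q i) / real (m i)"
    and "M = Lcm (m ` {..<n})"
    and "\<forall>i<n. p i = q i * (M div m i)"
    and "\<gamma> = 1 / real M"
    and "d = (\<Sum>i<n. p i)"
    and "B = companion_matrix d (b_coeff A p)"
  shows "order_spectrum \<alpha> A \<subseteq> left_half_plane \<longleftrightarrow> sector_spectrum \<gamma> B \<subseteq> Omega_sector \<gamma>"
proof -
  note A = assms(2)
  have M: "M > 0"
    using assms(4,5) by (auto simp: Lcm_0_iff zero_less_iff_neq_zero)
  have p: "p i \<ge> 1 \<and> \<alpha> i = real (p i) / real M" if i: "i < n" for i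
  proof -
    have "m i dvd M" using i assms(5) by auto
    then obtain c where c: "M = m i * c" by (elim dvdE)
    then have "p i = q i * c" "c > 0" using i assms(4,6) M by auto
    then show ?thesis using i assms(4) c by (auto simp: Suc_le_eq)
  qed
  have d: "d \<ge> 1"
  proof -
    have "1 \<le> p 0" using p[of 0] assms(1) by simp
    also have "p 0 \<le> d" using assms(1,8) by (auto intro: member_le_sum)
    finally show ?thesis .
  qed
  have spec_iff: "s \<in> sector_spectrum \<gamma> B \<longleftrightarrow> s ^ M \<in> order_spectrum \<alpha> A"
    if arg: "- (1 / real M) * pi < Arg s" "Arg s \<le> 1 / real M * pi" for s
  proof -
    have "(s ^ M) powr complex_of_real (\<alpha> i) = s ^ p i" if "i < n" for i
      using p[OF that] powr_power_sector[OF M arg, of "p i"] by simp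
    then have "mat_diag n (\<lambda>i. (s ^ M) powr complex_of_real (\<alpha> i)) = mat_diag n (\<lambda>i. s ^ p i)"
      by (intro eq_matI) (auto simp: mat_diag_def)
    then have "s ^ M \<in> order_spectrum \<alpha> A \<longleftrightarrow>
        det (mat_diag n (\<lambda>i. s ^ p i) - map_mat complex_of_real A) = 0"
      using A by (simp add: order_spectrum_def)
    also have "\<dots> \<longleftrightarrow> det (s \<cdot>\<^sub>m 1\<^sub>m d - map_mat complex_of_real B) = 0"
      using det_diag_powers_minus[OF A _ assms(8), of s] p
        det_companion_matrix_eq_0_iff[OF d, of s "b_coeff A p"] assms(9) by simp
    also have "\<dots> \<longleftrightarrow> s \<in> sector_spectrum \<gamma> B"
      using arg assms(7,9) by (simp add: sector_spectrum_def companion_matrix_def)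
    finally show ?thesis by simp
  qed
  have "order_spectrum \<alpha> A = (\<lambda>s. s ^ M) ` sector_spectrum \<gamma> B"
  proof
    show "order_spectrum \<alpha> A \<subseteq> (\<lambda>s. s ^ M) ` sector_spectrum \<gamma> B"
    proof
      fix z assume "z \<in> order_spectrum \<alpha> A"
      moreover obtain s where "- (1 / real M) * pi < Arg s" "Arg s \<le> 1 / real M * pi" "s ^ M = z"
        using sector_root_exists[OF M] .
      ultimately show "z \<in> (\<lambda>s. s ^ M) ` sector_spectrum \<gamma> B" using spec_iff by blast
    qed
    show "(\<lambda>s. s ^ M) ` sector_spectrum \<gamma> B \<subseteq> order_spectrum \<alpha> A"
      using spec_iff by (auto simp: sector_spectrum_def assms(7))
  qed
  moreover have "s ^ M \<in> left_half_plane \<longleftrightarrow> s \<in> Omega_sector \<gamma>" if "s \<in> sector_spectrum \<gamma> B" for s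
    using power_in_left_half_plane_iff[OF M] that by (auto simp: sector_spectrum_def assms(7))
  ultimately show ?thesis by auto
qed

end
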